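(* Let $F:\mathbb R^{d}\to\mathbb R$ be differentiable with $L$-Lipschitz gradient, $\|\nabla F(\boldsymbol x)-\nabla F(\boldsymbol y)\|\le L\|\boldsymbol x-\boldsymbol y\|$ for all $\boldsymbol x,\boldsymbol y\in\mathbb R^d$, with $L>0$. Let $0\le\epsilon<1$, and let $(\boldsymbol\xi_k)_{k\ge0}$ be random vectors in $\mathbb R^d$ generated by $\boldsymbol\xi_{k+1}=\boldsymbol\xi_k-\eta\boldsymbol\upsilon_k$ with step size $\eta=1/L$, where the random gradient estimates $\boldsymbol\upsilon_k$ satisfy, for all $k$, $$\mathbb E\|\boldsymbol\upsilon_k-\nabla F(\boldsymbol\xi_k)\|^2\le\epsilon^2\,\mathbb E\|\nabla F(\boldsymbol\xi_k)\|^2 .$$ Then, for all $k\ge0$, $$\mathbb E[F(\boldsymbol\xi_{k+1})]\le\mathbb E[F(\boldsymbol\xi_k)]-\frac{1-\epsilon^2}{2L}\,\mathbb E\|\nabla F(\boldsymbol\xi_k)\|^2 .$$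
   Context: All expectations appearing are assumed finite. No unbiasedness or independence of $\boldsymbol\upsilon_k$ is assumed. *)

theory Defs
  imports "HOL-Probability.Probability"
begin

end

theory Submission
  imports Defs
begin

text \<open>
  The step \<open>x \<mapsto> x - v / L\<close> taken from a point with gradient \<open>g\<close> minimises the model
  \<open>y \<mapsto> F x + v \<bullet> (y - x) + (L / 2) * (norm (y - x))\<^sup>2\<close>, in which the estimate \<open>v\<close> stands in for \<open>g\<close>. An
  \<open>L\<close>-Lipschitz gradient makes the same model with the true gradient an upper bound for \<open>F\<close>
  (\<open>descent_lemma\<close>). For the step size \<open>1 / L\<close> the value of that bound is a perfect square up to the
  gradient norm, so that for every \<open>v\<close> whatsoever
  \<open>F (x - v / L) \<le> F x - (norm g)\<^sup>2 / (2 * L) + (norm (v - g))\<^sup>2 / (2 * L)\<close> (\<open>inexact_gradient_step\<close>).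
  The cross term between \<open>v\<close> and \<open>g\<close> is absorbed in the square of the error \<open>v - g\<close>, so the inequality
  holds pointwise and survives any joint distribution of point and estimate. Taking expectations and
  bounding the mean squared error by \<open>\<epsilon>\<^sup>2\<close> times the mean squared gradient norm gives the claim.
\<close>

text \<open>
  Along the segment from \<open>x\<close> to \<open>x + d\<close> the slope of \<open>F\<close> exceeds its initial value by at most
  \<open>L * t * (norm d)\<^sup>2\<close>, by Cauchy-Schwarz and the Lipschitz bound. Hence \<open>F\<close> minus the quadratic model is
  nonincreasing in \<open>t\<close>. Monotonicity replaces the usual integral of the gradient along the segment.
\<close>
lemma descent_lemma:
  fixes F :: "'a::real_inner \<Rightarrow> real"
  assumes grad: "\<And>x. GDERIV F x :> g x"
    and lip: "\<And>x y. norm (g x - g y) \<le> L * norm (x - y)"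
  shows "F (x + d) \<le> F x + d \<bullet> g x + L / 2 * (norm d)\<^sup>2"
proof -
  define \<phi> where "\<phi> t = F (x + t *\<^sub>R d) - t * (d \<bullet> g x) - L / 2 * t\<^sup>2 * (norm d)\<^sup>2" for t
  have deriv: "(\<phi> has_real_derivative d \<bullet> (g (x + t *\<^sub>R d) - g x) - L * t * (norm d)\<^sup>2) (at t)" for t
  proof -
    have "((\<lambda>t. x + t *\<^sub>R d) has_derivative (\<lambda>h. h *\<^sub>R d)) (at t)"
      by (auto intro!: derivative_eq_intros)
    moreover have "(F has_derivative (\<lambda>h. h \<bullet> g (x + t *\<^sub>R d))) (at (x + t *\<^sub>R d))"
      using grad unfolding gderiv_def by blast
    ultimately have "((\<lambda>t. F (x + t *\<^sub>R d)) has_derivative (\<lambda>h. (h *\<^sub>R d) \<bullet> g (x + t *\<^sub>R d))) (at t)"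
      by (rule has_derivative_compose)
    then have "((\<lambda>t. F (x + t *\<^sub>R d)) has_real_derivative d \<bullet> g (x + t *\<^sub>R d)) (at t)"
      by (simp add: has_field_derivative_def mult.commute[of _ "d \<bullet> g (x + t *\<^sub>R d)"])
    then show ?thesis
      unfolding \<phi>_def[abs_def]
      by (auto intro!: derivative_eq_intros simp: inner_diff_right)
  qed
  have slope: "d \<bullet> (g (x + t *\<^sub>R d) - g x) - L * t * (norm d)\<^sup>2 \<le> 0" if "0 \<le> t" for t
  proof -
    have "d \<bullet> (g (x + t *\<^sub>R d) - g x) \<le> norm d * norm (g (x + t *\<^sub>R d) - g x)"
      by (rule norm_cauchy_schwarz)
    also have "\<dots> \<le> norm d * (L * norm (t *\<^sub>R d))"
      using lip[of "x + t *\<^sub>R d" x] by (intro mult_left_mono) auto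
    also have "\<dots> = L * t * (norm d)\<^sup>2"
      using that by (simp add: power2_eq_square)
    finally show ?thesis by simp
  qed
  have "\<phi> 1 \<le> \<phi> 0"
  proof (rule DERIV_nonpos_imp_nonincreasing[of 0 1 \<phi>])
    show "\<exists>y. (\<phi> has_real_derivative y) (at t) \<and> y \<le> 0" if "0 \<le> t" for t
      using deriv[of t] slope[OF that] by blast
  qed simp
  then show ?thesis
    by (simp add: \<phi>_def)
qed

text \<open>
  Completing the square: the model value \<open>- (v \<bullet> g x) / L + (norm v)\<^sup>2 / (2 * L)\<close> of the step
  is the polarised form of the right-hand side.
\<close>
lemma inexact_gradient_step:
  fixes F :: "'a::real_inner \<Rightarrow> real"
  assumes grad: "\<And>x. GDERIV F x :> g x"
    and lip: "\<And>x y. norm (g x - g y) \<le> L * norm (x - y)"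
    and "L > 0"
  shows "F (x - (1 / L) *\<^sub>R v) \<le> F x - (norm (g x))\<^sup>2 / (2 * L) + (norm (v - g x))\<^sup>2 / (2 * L)"
proof -
  let ?d = "- (1 / L) *\<^sub>R v"
  have "F (x + ?d) \<le> F x + ?d \<bullet> g x + L / 2 * (norm ?d)\<^sup>2"
    by (rule descent_lemma[OF grad lip])
  also have "\<dots> = F x - (v \<bullet> g x) / L + (norm v)\<^sup>2 / (2 * L)"
    using \<open>L > 0\<close> by (simp add: power_mult_distrib power2_eq_square)
  also have "\<dots> = F x - (norm (g x))\<^sup>2 / (2 * L) + (norm (v - g x))\<^sup>2 / (2 * L)"
    using \<open>L > 0\<close>
    by (simp add: power2_norm_eq_inner inner_diff_left inner_diff_right inner_commute field_simps)
  finally show ?thesis by simp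
qed

theorem proposition1:
  fixes F :: "real ^ 'd \<Rightarrow> real"
    and gradF :: "real ^ 'd \<Rightarrow> real ^ 'd"
    and L \<epsilon> \<eta> :: real
    and M :: "'w measure"
    and \<xi> \<upsilon> :: "nat \<Rightarrow> 'w \<Rightarrow> real ^ 'd"
  assumes "\<And>x. GDERIV F x :> gradF x"
    and "L > 0"
    and "\<And>x y. norm (gradF x - gradF y) \<le> L * norm (x - y)"
    and "0 \<le> \<epsilon>" and "\<epsilon> < 1"
    and "prob_space M"
    and "\<And>k. \<xi> k \<in> borel_measurable M"
    and "\<And>k. \<upsilon> k \<in> borel_measurable M"
    and "\<eta> = 1 / L"
    and "\<And>k \<omega>. \<omega> \<in> space M \<Longrightarrow> \<xi> (Suc k) \<omega> = \<xi> k \<omega> - \<eta> *\<^sub>R \<upsilon> k \<omega>"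
    and "\<And>k. integrable M (\<lambda>\<omega>. F (\<xi> k \<omega>))"
    and "\<And>k. integrable M (\<lambda>\<omega>. (norm (gradF (\<xi> k \<omega>)))\<^sup>2)"
    and "\<And>k. integrable M (\<lambda>\<omega>. (norm (\<upsilon> k \<omega> - gradF (\<xi> k \<omega>)))\<^sup>2)"
    and "\<And>k. (\<integral>\<omega>. (norm (\<upsilon> k \<omega> - gradF (\<xi> k \<omega>)))\<^sup>2 \<partial>M)
              \<le> \<epsilon>\<^sup>2 * (\<integral>\<omega>. (norm (gradF (\<xi> k \<omega>)))\<^sup>2 \<partial>M)"
  shows "\<forall>k. (\<integral>\<omega>. F (\<xi> (Suc k) \<omega>) \<partial>M)
           \<le> (\<integral>\<omega>. F (\<xi> k \<omega>) \<partial>M)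
              - (1 - \<epsilon>\<^sup>2) / (2 * L) * (\<integral>\<omega>. (norm (gradF (\<xi> k \<omega>)))\<^sup>2 \<partial>M)"
proof
  fix k
  let ?G = "\<lambda>\<omega>. (norm (gradF (\<xi> k \<omega>)))\<^sup>2"
  let ?E = "\<lambda>\<omega>. (norm (\<upsilon> k \<omega> - gradF (\<xi> k \<omega>)))\<^sup>2"
  note int = assms(11)[of k] assms(12)[of k] assms(13)[of k]
  have "(\<integral>\<omega>. F (\<xi> (Suc k) \<omega>) \<partial>M) \<le> (\<integral>\<omega>. F (\<xi> k \<omega>) - ?G \<omega> / (2 * L) + ?E \<omega> / (2 * L) \<partial>M)"
  proof (rule integral_mono)
    show "integrable M (\<lambda>\<omega>. F (\<xi> (Suc k) \<omega>))"
      by (rule assms(11))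
    show "integrable M (\<lambda>\<omega>. F (\<xi> k \<omega>) - ?G \<omega> / (2 * L) + ?E \<omega> / (2 * L))"
      using int by simp
    show "F (\<xi> (Suc k) \<omega>) \<le> F (\<xi> k \<omega>) - ?G \<omega> / (2 * L) + ?E \<omega> / (2 * L)"
      if "\<omega> \<in> space M" for \<omega>
      using inexact_gradient_step[OF assms(1,3,2)] assms(9) assms(10)[OF that] by simp
  qed
  also have "\<dots> = (\<integral>\<omega>. F (\<xi> k \<omega>) \<partial>M) - (\<integral>\<omega>. ?G \<omega> \<partial>M) / (2 * L) + (\<integral>\<omega>. ?E \<omega> \<partial>M) / (2 * L)"
    using int by simp
  also have "\<dots> \<le> (\<integral>\<omega>. F (\<xi> k \<omega>) \<partial>M) - (\<integral>\<omega>. ?G \<omega> \<partial>M) / (2 * L)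
                  + \<epsilon>\<^sup>2 * (\<integral>\<omega>. ?G \<omega> \<partial>M) / (2 * L)"
    using assms(14)[of k] \<open>L > 0\<close> by (simp add: divide_right_mono)
  also have "\<dots> = (\<integral>\<omega>. F (\<xi> k \<omega>) \<partial>M) - (1 - \<epsilon>\<^sup>2) / (2 * L) * (\<integral>\<omega>. ?G \<omega> \<partial>M)"
    by (simp add: diff_divide_distrib left_diff_distrib)
  finally show "(\<integral>\<omega>. F (\<xi> (Suc k) \<omega>) \<partial>M)
    \<le> (\<integral>\<omega>. F (\<xi> k \<omega>) \<partial>M) - (1 - \<epsilon>\<^sup>2) / (2 * L) * (\<integral>\<omega>. ?G \<omega> \<partial>M)" .
qed

end
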